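(* Let $a,b>0$ be real with $a\neq b$, let $r,k$ be nonnegative integers, and let $\bar\alpha_r=(\alpha_0,\dots,\alpha_{r-1})$ be a sequence of complex numbers with $\alpha_i\neq 1$ for all $i$. Then for all $x,y,z\in\mathbb{R}$ and every integer $n\ge 0$, $${}_{p}\mathbb{M}_{n}^{(r)}(x+z,y;k,a,b;\bar\alpha_{r})=\sum_{m=0}^{n}\binom{n}{m}\,{}_{p}\mathbb{M}_{m}^{(r)}(x,y;k,a,b;\bar\alpha_{r})\,z^{n-m}.$$
   Context: All generating functions are understood as formal power series in $t$ (with $b^t=e^{t\log b}$, $a^t=e^{t\log a}$), and $0^0=1$. Fix a family of functions $\varphi_n(y)$ and the series $\varphi(y,t)=\sum_{n\ge0}\varphi_n(y)\frac{t^n}{n!}$ with $\varphi_0(y)\neq0$. The 2-variable general polynomials $p_n(x,y)$ are defined by $e^{xt}\varphi(y,t)=\sum_{n\ge 0}p_n(x,y)\frac{t^n}{n!}$, with $p_0(x,y)=1$. The 2-variable unified family ${}_{p}\mathbb{M}_{n}^{(r)}(x,y;k,a,b;\bar\alpha_r)$ of generalized Apostol-Euler, Bernoulli and Genocchi polynomials of order $r$ is defined by $$\sum_{n=0}^{\infty}{}_{p}\mathbb{M}_{n}^{(r)}(x,y;k,a,b;\bar\alpha_{r})\frac{t^{n}}{n!}=\frac{(-1)^{r}t^{rk}2^{r(1-k)}}{\prod_{i=0}^{r-1}(\alpha_{i}b^{t}-a^{t})}\,e^{xt}\varphi(y,t).$$ The left subscript $p$ is only a label referring to the family $p_n(x,y)$.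 *)

theory Defs
  imports Complex_Main "HOL-Computational_Algebra.Formal_Power_Series"
begin

definition egf :: "(nat \<Rightarrow> complex) \<Rightarrow> complex fps" where
  "egf c = Abs_fps (\<lambda>n. c n / fact n)"

definition egf_coeff :: "complex fps \<Rightarrow> nat \<Rightarrow> complex" where
  "egf_coeff F n = fact n * fps_nth F n"

lemma egf_egf_coeff: "egf (egf_coeff F) = F"
  by (simp add: egf_def egf_coeff_def fps_eq_iff)

lemma egf_coeff_egf: "egf_coeff (egf c) = c"
  by (simp add: egf_def egf_coeff_def fun_eq_iff)

(* The series exp(x t) phi(y,t), where phi(y,t) = sum_n phi_n(y) t^n / n!. *)
definition gen_poly_series :: "(nat \<Rightarrow> real \<Rightarrow> complex) \<Rightarrow> real \<Rightarrow> real \<Rightarrow> complex fps" where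
  "gen_poly_series \<phi> x y = fps_exp (of_real x) * egf (\<lambda>n. \<phi> n y)"

definition gen_poly :: "(nat \<Rightarrow> real \<Rightarrow> complex) \<Rightarrow> nat \<Rightarrow> real \<Rightarrow> real \<Rightarrow> complex" where
  "gen_poly \<phi> n x y = egf_coeff (gen_poly_series \<phi> x y) n"

(* prod_{i<r} (alpha_i b^t - a^t), with c^t = exp(t ln c) for c > 0. *)
definition unified_denom :: "nat \<Rightarrow> real \<Rightarrow> real \<Rightarrow> (nat \<Rightarrow> complex) \<Rightarrow> complex fps" where
  "unified_denom r a b \<alpha> =
     (\<Prod>i<r. fps_const (\<alpha> i) * fps_exp (of_real (ln b)) - fps_exp (of_real (ln a)))"

(* The exponent r(1 - k) of 2 may be negative, hence the integer power. *)
definition unified_series ::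
  "(nat \<Rightarrow> real \<Rightarrow> complex) \<Rightarrow> nat \<Rightarrow> real \<Rightarrow> real \<Rightarrow> nat \<Rightarrow> real \<Rightarrow> real \<Rightarrow>
     (nat \<Rightarrow> complex) \<Rightarrow> complex fps" where
  "unified_series \<phi> r x y k a b \<alpha> =
     (fps_const ((-1) ^ r) * fps_X ^ (r * k) * fps_const (2 powi (int r * (1 - int k))))
       / unified_denom r a b \<alpha> * gen_poly_series \<phi> x y"

definition unifiedM ::
  "(nat \<Rightarrow> real \<Rightarrow> complex) \<Rightarrow> nat \<Rightarrow> nat \<Rightarrow> real \<Rightarrow> real \<Rightarrow> nat \<Rightarrow> real \<Rightarrow> real \<Rightarrow>
     (nat \<Rightarrow> complex) \<Rightarrow> complex" where
  "unifiedM \<phi> r n x y k a b \<alpha> = egf_coeff (unified_series \<phi> r x y k a b \<alpha>) n"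

(* For alpha_i distinct from 1 the denominator has a nonzero constant term,
   so the division above is a genuine quotient of formal power series. *)
lemma unified_denom_nth_0: "fps_nth (unified_denom r a b \<alpha>) 0 = (\<Prod>i<r. \<alpha> i - 1)"
  by (induction r) (simp_all add: unified_denom_def fps_mult_nth_0)

lemma egf_unifiedM:
  assumes "\<forall>i<r. \<alpha> i \<noteq> 1"
  shows "unified_denom r a b \<alpha> * egf (\<lambda>n. unifiedM \<phi> r n x y k a b \<alpha>) =
           fps_const ((-1) ^ r) * fps_X ^ (r * k) * fps_const (2 powi (int r * (1 - int k)))
             * gen_poly_series \<phi> x y"
proof -
  have u: "fps_nth (unified_denom r a b \<alpha>) 0 \<noteq> 0"
    using assms by (simp add: unified_denom_nth_0)
  let ?D = "unified_denom r a b \<alpha>" and ?G = "gen_poly_series \<phi> x y"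
  let ?N = "fps_const ((-1) ^ r) * fps_X ^ (r * k) * fps_const (2 powi (int r * (1 - int k))) :: complex fps"
  have "egf (\<lambda>n. unifiedM \<phi> r n x y k a b \<alpha>) = ?N * inverse ?D * ?G"
    unfolding unifiedM_def egf_egf_coeff unified_series_def fps_divide_unit[OF u] ..
  then have "?D * egf (\<lambda>n. unifiedM \<phi> r n x y k a b \<alpha>) = (?D * inverse ?D) * (?N * ?G)"
    by (simp only: mult_ac)
  also have "?D * inverse ?D = 1"
    by (rule inverse_mult_eq_1'[OF u])
  finally show ?thesis
    by (simp only: mult_1_left)
qed

end

theory Submission imports Defs begin

text \<open>
  The variable \<open>x\<close> enters the generating series only through the factor \<open>exp (x t)\<close>, so by
  \<open>exp ((x + z) t) = exp (x t) * exp (z t)\<close> a shift of \<open>x\<close> by \<open>z\<close> multiplies the whole series by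
  \<open>exp (z t)\<close> (lemma \<open>unified_series_shift\<close>).
  The powers \<open>z ^ n\<close> have exponential generating series \<open>exp (z t)\<close>, and a product of exponential
  generating series corresponds to the binomial convolution of their coefficients
  (lemma \<open>egf_coeff_mult\<close>). Comparing coefficients gives the addition formula.
\<close>

text \<open>
  The Cauchy product, renormalised: the factor \<open>n! / (m! (n - m)!)\<close> that converts between
  ordinary and exponential coefficients is the binomial coefficient.
\<close>
lemma egf_coeff_mult:
  "egf_coeff (F * G) n =
     (\<Sum>m=0..n. of_nat (n choose m) * egf_coeff F m * egf_coeff G (n - m))"
proof -
  have "fact n * (fps_nth F m * fps_nth G (n - m)) =
      of_nat (n choose m) * egf_coeff F m * egf_coeff G (n - m)" if "m \<in> {0..n}" for m
    using that by (simp add: egf_coeff_def binomial_fact)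
  then show ?thesis
    unfolding egf_coeff_def[of "F * G"] fps_mult_nth sum_distrib_left
    by (intro sum.cong) auto
qed

lemma egf_coeff_exp: "egf_coeff (fps_exp w) n = w ^ n"
  by (simp add: egf_coeff_def)

lemma unified_series_shift:
  "unified_series \<phi> r (x + z) y k a b \<alpha> =
     unified_series \<phi> r x y k a b \<alpha> * fps_exp (of_real z)"
  unfolding unified_series_def gen_poly_series_def of_real_add fps_exp_add_mult
  by (simp only: mult_ac)

theorem theorem3p1:
  fixes \<phi> :: "nat \<Rightarrow> real \<Rightarrow> complex"
    and a b x y z :: real and r k n :: nat and \<alpha> :: "nat \<Rightarrow> complex"
  assumes "\<And>y. \<phi> 0 y \<noteq> 0"
    and "\<And>x y. gen_poly \<phi> 0 x y = 1"
    and "a > 0" and "b > 0" and "a \<noteq> b"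
    and "\<And>i. i < r \<Longrightarrow> \<alpha> i \<noteq> 1"
  shows "unifiedM \<phi> r n (x + z) y k a b \<alpha> =
    (\<Sum>m=0..n. of_nat (n choose m) * unifiedM \<phi> r m x y k a b \<alpha> * of_real z ^ (n - m))"
  unfolding unifiedM_def unified_series_shift egf_coeff_mult egf_coeff_exp ..

end
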